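(* Let $c>1$ be a constant and, for $n>c$, let $p=c/n$. Let $G$ and $H$ be two independent Erdős–Rényi graphs $G(n,p)$ and let $I(G\times H)$ denote the number of isolated vertices of $G\times H$. Then $$\frac{I(G\times H)}{2n^2(1-p)^{n-1}-n^2(1-p)^{2n-2}}\to 1\quad\text{in probability as } n\to\infty.$$
   Context: An Erdős–Rényi graph $G(n,p)$ is a random simple graph on $\{1,\dots,n\}$ with each edge present independently with probability $p$. The tensor product $G\times H$ has vertex set $V(G)\times V(H)$, with $(v_1,v_2)$ adjacent to $(v_1',v_2')$ iff $v_1v_1'\in E(G)$ and $v_2v_2'\in E(H)$. A vertex is isolated if it has degree $0$. *)

theory Defs
  imports "HOL-Probability.Probability" "HOL-Library.Ramsey"
begin

text \<open>
  A simple graph is given by its vertices and its edges, the latter being unordered pairs, that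
  is, two-element sets of vertices. The datatype does not enforce this, but every graph in the
  support of the random graph model below and every tensor product of such graphs satisfies it.
\<close>

datatype 'a graph = Graph (verts: "'a set") (edges: "'a set set")

text \<open>Meaningful for finite graphs only, since \<^const>\<open>card\<close> is 0 on infinite sets.\<close>

definition degree :: "'a graph \<Rightarrow> 'a \<Rightarrow> nat" where
  "degree G v = card {w \<in> verts G. {v, w} \<in> edges G}"

definition isolated_vertices :: "'a graph \<Rightarrow> 'a set" where
  "isolated_vertices G = {v \<in> verts G. degree G v = 0}"

definition tensor_product :: "'a graph \<Rightarrow> 'b graph \<Rightarrow> ('a \<times> 'b) graph" where
  "tensor_product G H =
     Graph (verts G \<times> verts H)
       {{(v1, v2), (w1, w2)} | v1 v2 w1 w2. {v1, w1} \<in> edges G \<and> {v2, w2} \<in> edges H}"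

text \<open>
  One independent Bernoulli variable per two-element subset of \<open>{1..n}\<close>. Note that
  \<^const>\<open>bernoulli_pmf\<close> truncates its parameter to the unit interval, so this is the
  Erdos-Renyi graph only for \<open>0 \<le> p \<le> 1\<close>.
\<close>

definition erdos_renyi :: "nat \<Rightarrow> real \<Rightarrow> nat graph pmf" where
  "erdos_renyi n p =
     map_pmf (\<lambda>present. Graph {1..n} {e \<in> nsets {1..n} 2. present e})
       (Pi_pmf (nsets {1..n} 2) False (\<lambda>_. bernoulli_pmf p))"

text \<open>
  Convergence in probability to a constant. The random variables may live on different
  probability spaces.
\<close>

definition converges_in_probability ::
    "(nat \<Rightarrow> 'a measure) \<Rightarrow> (nat \<Rightarrow> 'a \<Rightarrow> real) \<Rightarrow> real \<Rightarrow> bool" where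
  "converges_in_probability M X a \<longleftrightarrow>
     (\<forall>n. X n \<in> borel_measurable (M n)) \<and>
     (\<forall>\<epsilon>>0. (\<lambda>n. measure (M n) {\<omega> \<in> space (M n). \<bar>X n \<omega> - a\<bar> > \<epsilon>}) \<longlonglongrightarrow> 0)"

end

theory Submission
  imports Defs
begin

text \<open>
  A vertex of \<open>G \<times> H\<close> is isolated iff one of its two components is, so
  \<open>I(G \<times> H) = n\<^sup>2 - (n - X) (n - Y)\<close> for the numbers \<open>X\<close>, \<open>Y\<close> of isolated vertices of \<open>G\<close>, \<open>H\<close>.
  With \<open>q = (1 - p)\<^bsup>n-1\<^esup>\<close> the denominator is \<open>n\<^sup>2 - (n - n q)\<^sup>2 \<ge> n\<^sup>2 q\<close>. It therefore suffices
  that \<open>X / n\<close> is concentrated around \<open>q\<close>, which follows from Chebyshev's inequality, because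
  \<open>Var X / (n q)\<^sup>2 \<le> 1 / (n q) + 1 / (1 - p) - 1\<close> and \<open>q\<close> is bounded away from 0.
\<close>

section \<open>Isolated vertices of a tensor product\<close>

lemma isolated_vertices_iff:
  assumes "finite (verts G)"
  shows "v \<in> isolated_vertices G \<longleftrightarrow> v \<in> verts G \<and> (\<forall>w\<in>verts G. {v, w} \<notin> edges G)"
  using assms by (auto simp: isolated_vertices_def degree_def)

text \<open>The neighbourhood of a pair is the product of the neighbourhoods of its components, so
  it is empty iff one factor is; hence the non-isolated vertices form a product set.\<close>

lemma isolated_vertices_tensor_product:
  assumes "finite (verts G)" "finite (verts H)"
  shows "isolated_vertices (tensor_product G H) =
           verts G \<times> verts H - (verts G - isolated_vertices G) \<times> (verts H - isolated_vertices H)"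
proof -
  \<comment> \<open>An unordered pair fixes its endpoints only up to a swap, which exchanges both
    coordinates at once and so leaves \<open>{a, c}\<close> and \<open>{b, d}\<close>
    unchanged.\<close>
  have edge: "{(a, b), (c, d)} \<in> edges (tensor_product G H) \<longleftrightarrow>
      {a, c} \<in> edges G \<and> {b, d} \<in> edges H" for a b c d
    by (fastforce simp: tensor_product_def doubleton_eq_iff insert_commute)
  have fin: "finite (verts (tensor_product G H))"
    and verts: "verts (tensor_product G H) = verts G \<times> verts H"
    using assms by (auto simp: tensor_product_def)
  show ?thesis
    using assms by (auto simp: isolated_vertices_iff[OF fin] isolated_vertices_iff edge verts)
qed

lemma card_isolated_vertices_tensor_product:
  assumes "finite (verts G)" "finite (verts H)"
  shows "real (card (isolated_vertices (tensor_product G H))) =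
     real (card (verts G)) * real (card (verts H)) -
     (real (card (verts G)) - real (card (isolated_vertices G))) *
     (real (card (verts H)) - real (card (isolated_vertices H)))"
proof -
  have sub: "isolated_vertices G \<subseteq> verts G" "isolated_vertices H \<subseteq> verts H"
    by (auto simp: isolated_vertices_def)
  have fin: "finite (isolated_vertices G)" "finite (isolated_vertices H)"
    using sub assms finite_subset by blast+
  have le: "card (isolated_vertices G) \<le> card (verts G)" "card (isolated_vertices H) \<le> card (verts H)"
    using sub assms card_mono by blast+
  have "card (isolated_vertices (tensor_product G H)) =
      card (verts G) * card (verts H) -
      (card (verts G) - card (isolated_vertices G)) * (card (verts H) - card (isolated_vertices H))"
    unfolding isolated_vertices_tensor_product[OF assms]
    using assms sub fin
    by (subst card_Diff_subset) (auto simp: card_cartesian_product card_Diff_subset)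
  moreover have "(card (verts G) - card (isolated_vertices G)) * (card (verts H) - card (isolated_vertices H))
      \<le> card (verts G) * card (verts H)"
    by (intro mult_mono) auto
  ultimately show ?thesis
    using le by (simp add: of_nat_diff)
qed

section \<open>Probability that given vertices are isolated\<close>

lemma prob_Pi_bernoulli_all_False:
  assumes "finite A" "S \<subseteq> A" "0 \<le> p" "p \<le> 1"
  shows "measure_pmf.prob (Pi_pmf A d (\<lambda>_. bernoulli_pmf p)) {f. \<forall>x\<in>S. \<not> f x} = (1 - p) ^ card S"
proof -
  have "{f. \<forall>x\<in>S. \<not> f x} = Pi A (\<lambda>x. if x \<in> S then {False} else UNIV)"
    using assms(2) by (auto simp: Pi_def)
  then have "measure_pmf.prob (Pi_pmf A d (\<lambda>_. bernoulli_pmf p)) {f. \<forall>x\<in>S. \<not> f x} =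
      (\<Prod>x\<in>A. if x \<in> S then 1 - p else 1)"
    using assms by (auto simp: measure_Pi_pmf_Pi measure_pmf_single intro!: prod.cong)
  also have "\<dots> = (\<Prod>x\<in>S. 1 - p)"
    using assms by (simp add: prod.If_cases Int_absorb1)
  finally show ?thesis by simp
qed

text \<open>These are the potential edges at \<open>v\<close>, independent of any graph;
  \<open>v\<close> is isolated iff all of them are absent.\<close>

definition incident_pairs :: "'a set \<Rightarrow> 'a \<Rightarrow> 'a set set" where
  "incident_pairs V v = {e \<in> nsets V 2. v \<in> e}"

lemma incident_pairs_eq_image:
  "v \<in> V \<Longrightarrow> incident_pairs V v = (\<lambda>w. {v, w}) ` (V - {v})"
  by (fastforce simp: incident_pairs_def elim: nsets2_E)

lemma card_incident_pairs:
  assumes "finite V" "v \<in> V"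
  shows "card (incident_pairs V v) = card V - 1"
proof -
  have "inj_on (\<lambda>w. {v, w}) (V - {v})"
    by (auto simp: inj_on_def doubleton_eq_iff)
  then show ?thesis
    using assms by (simp add: incident_pairs_eq_image card_image)
qed

text \<open>Inclusion-exclusion: the two stars share exactly the pair \<open>{v, w}\<close>, which
  gives \<open>2 * (card V - 1) - 1\<close>.\<close>

lemma card_incident_pairs_Un:
  assumes "finite V" "v \<in> V" "w \<in> V" "v \<noteq> w"
  shows "card (incident_pairs V v \<union> incident_pairs V w) = 2 * card V - 3"
proof -
  have fin: "finite (incident_pairs V u)" for u
    using assms by (simp add: incident_pairs_def finite_imp_finite_nsets)
  have "incident_pairs V v \<inter> incident_pairs V w = {{v, w}}"
    using assms by (auto simp: incident_pairs_def elim!: nsets2_E)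
  moreover have "card {v, w} \<le> card V"
    using assms by (intro card_mono) auto
  ultimately show ?thesis
    using card_Un_Int[OF fin[of v] fin[of w]] assms by (simp add: card_incident_pairs)
qed

lemma verts_erdos_renyi: "G \<in> set_pmf (erdos_renyi n p) \<Longrightarrow> verts G = {1..n}"
  by (auto simp: erdos_renyi_def)

text \<open>All of \<open>W\<close> is isolated iff every potential edge meeting \<open>W\<close> is
  absent, and these absences are independent. Stating this for a set \<open>W\<close> covers single
  vertices and pairs at once.\<close>

lemma prob_erdos_renyi_isolated:
  assumes "0 \<le> p" "p \<le> 1" "W \<subseteq> {1..n}"
  shows "measure_pmf.prob (erdos_renyi n p) {G. W \<subseteq> isolated_vertices G} =
           (1 - p) ^ card (\<Union>v\<in>W. incident_pairs {1..n} v)"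
proof -
  have "W \<subseteq> isolated_vertices (Graph {1..n} {e \<in> nsets {1..n} 2. f e}) \<longleftrightarrow>
      (\<forall>e\<in>\<Union>v\<in>W. incident_pairs {1..n} v. \<not> f e)" for f
  proof -
    have "v \<in> isolated_vertices (Graph {1..n} {e \<in> nsets {1..n} 2. f e}) \<longleftrightarrow>
        (\<forall>e\<in>incident_pairs {1..n} v. \<not> f e)" if "v \<in> W" for v
      using that assms(3) by (auto simp: isolated_vertices_iff incident_pairs_eq_image subset_iff)
    then show ?thesis
      by (auto simp: subset_iff)
  qed
  then have "(\<lambda>f. Graph {1..n} {e \<in> nsets {1..n} 2. f e}) -` {G. W \<subseteq> isolated_vertices G} =
      {f. \<forall>e\<in>\<Union>v\<in>W. incident_pairs {1..n} v. \<not> f e}"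
    by auto
  then show ?thesis
    unfolding erdos_renyi_def measure_map_pmf
    using assms(1,2)
    by (subst prob_Pi_bernoulli_all_False[symmetric, of "nsets {1..n} 2"])
       (auto simp: finite_imp_finite_nsets incident_pairs_def)
qed

text \<open>The diagonal case is included so that one formula serves every term of the double sum in
  the second moment.\<close>

lemma prob_isolated_pair:
  assumes "0 \<le> p" "p \<le> 1" "v \<in> {1..n}" "w \<in> {1..n}"
  shows "measure_pmf.prob (erdos_renyi n p) {G. v \<in> isolated_vertices G \<and> w \<in> isolated_vertices G} =
           (if v = w then (1 - p) ^ (n - 1) else (1 - p) ^ (2 * n - 3))"
  using prob_erdos_renyi_isolated[OF assms(1,2), of "{v, w}" n] assms(3,4)
    card_incident_pairs[of "{1..n}" v] card_incident_pairs_Un[of "{1..n}" v w]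
  by (auto simp: Un_ac)

section \<open>Concentration of the number of isolated vertices\<close>

text \<open>Chebyshev's inequality; the numerator is the exact variance of the count, from
  \<open>n\<close> diagonal and \<open>n * (n - 1)\<close> off-diagonal pairs of vertices.\<close>

lemma isolated_vertices_concentration:
  fixes n :: nat and p a q :: real
  defines "q \<equiv> (1 - p) ^ (n - 1)"
  assumes p: "0 \<le> p" "p \<le> 1" and a: "a > 0"
  shows "measure_pmf.prob (erdos_renyi n p) {G. a \<le> \<bar>real (card (isolated_vertices G)) - n * q\<bar>}
           \<le> (n * q + real n * (real n - 1) * (1 - p) ^ (2 * n - 3) - (n * q)\<^sup>2) / a\<^sup>2"
proof -
  let ?M = "measure_pmf (erdos_renyi n p)"
  define A where "A = (\<lambda>v. {G :: nat graph. v \<in> isolated_vertices G})"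
  define X where "X = (\<lambda>G. \<Sum>v\<in>{1..n}. indicator (A v) G :: real)"
  \<comment> \<open>The count and the indicator sum \<open>X\<close> are compared only on the
    support, where the vertex set is \<open>{1..n}\<close>; the events below are therefore equated
    almost surely.\<close>
  have X_eq: "real (card (isolated_vertices G)) = X G" if "G \<in> set_pmf (erdos_renyi n p)" for G
  proof -
    have "isolated_vertices G = {v \<in> {1..n}. G \<in> A v}"
      using verts_erdos_renyi[OF that] by (auto simp: A_def isolated_vertices_def)
    then show ?thesis
      by (simp add: X_def indicator_def sum.If_cases Int_def)
  qed
  have X_sq: "(X G)\<^sup>2 = (\<Sum>v\<in>{1..n}. \<Sum>w\<in>{1..n}. indicator (A v \<inter> A w) G)" for G
    by (simp add: X_def power2_eq_square sum_product indicator_inter_arith)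
  have int: "integrable ?M X"
    unfolding X_def by (intro Bochner_Integration.integrable_sum integrable_real_indicator) (auto simp: measure_pmf.emeasure_eq_measure)
  have int_sq: "integrable ?M (\<lambda>G. (X G)\<^sup>2)"
    unfolding X_sq by (intro Bochner_Integration.integrable_sum integrable_real_indicator) (auto simp: measure_pmf.emeasure_eq_measure)
  have prob_A: "measure_pmf.prob (erdos_renyi n p) (A v \<inter> A w) =
      (if v = w then q else (1 - p) ^ (2 * n - 3))" if "v \<in> {1..n}" "w \<in> {1..n}" for v w
    using prob_isolated_pair[OF p that] by (simp add: A_def q_def Collect_conj_eq)
  have mean: "measure_pmf.expectation (erdos_renyi n p) X = n * q"
  proof -
    have "measure_pmf.expectation (erdos_renyi n p) X =
        (\<Sum>v\<in>{1..n}. measure_pmf.prob (erdos_renyi n p) (A v))"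
      unfolding X_def by (subst Bochner_Integration.integral_sum) (auto simp: measure_pmf.emeasure_eq_measure)
    also have "\<dots> = (\<Sum>v\<in>{1..n}. q)"
      using prob_A by (intro sum.cong refl) (metis Int_absorb)
    finally show ?thesis by simp
  qed
  have second: "measure_pmf.expectation (erdos_renyi n p) (\<lambda>G. (X G)\<^sup>2) =
      n * q + real n * (real n - 1) * (1 - p) ^ (2 * n - 3)"
  proof -
    have "measure_pmf.expectation (erdos_renyi n p) (\<lambda>G. (X G)\<^sup>2) =
        (\<Sum>v\<in>{1..n}. \<Sum>w\<in>{1..n}. measure_pmf.prob (erdos_renyi n p) (A v \<inter> A w))"
      unfolding X_sq
      by (subst Bochner_Integration.integral_sum; (intro sum.cong refl)?)
         (auto simp: measure_pmf.emeasure_eq_measure Bochner_Integration.integral_sum)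
    also have "\<dots> = (\<Sum>v\<in>{1..n}. q + (real n - 1) * (1 - p) ^ (2 * n - 3))"
    proof (intro sum.cong refl)
      fix v assume v: "v \<in> {1..n}"
      have "(\<Sum>w\<in>{1..n}. measure_pmf.prob (erdos_renyi n p) (A v \<inter> A w)) =
          (\<Sum>w\<in>{1..n}. if v = w then q else (1 - p) ^ (2 * n - 3))"
        using prob_A v by (intro sum.cong) auto
      also have "\<dots> = q + (\<Sum>w\<in>{1..n} - {v}. (1 - p) ^ (2 * n - 3))"
        using v by (subst sum.remove[of _ v]) (auto intro!: sum.cong)
      also have "\<dots> = q + (real n - 1) * (1 - p) ^ (2 * n - 3)"
        using v by (simp add: of_nat_diff)
      finally show "(\<Sum>w\<in>{1..n}. measure_pmf.prob (erdos_renyi n p) (A v \<inter> A w)) =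
          q + (real n - 1) * (1 - p) ^ (2 * n - 3)" .
    qed
    also have "\<dots> = n * q + real n * (real n - 1) * (1 - p) ^ (2 * n - 3)"
      by (simp add: algebra_simps)
    finally show ?thesis .
  qed
  have "measure_pmf.prob (erdos_renyi n p) {G. a \<le> \<bar>real (card (isolated_vertices G)) - n * q\<bar>} =
      measure_pmf.prob (erdos_renyi n p) {G. a \<le> \<bar>X G - n * q\<bar>}"
    by (intro measure_pmf.finite_measure_eq_AE) (auto simp: AE_measure_pmf_iff X_eq)
  also have "\<dots> \<le> measure_pmf.variance (erdos_renyi n p) X / a\<^sup>2"
    using measure_pmf.Chebyshev_inequality[of X "erdos_renyi n p" a] int_sq a mean by simp
  also have "measure_pmf.variance (erdos_renyi n p) X =
      n * q + real n * (real n - 1) * (1 - p) ^ (2 * n - 3) - (n * q)\<^sup>2"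
    using measure_pmf.variance_eq[OF int int_sq] mean second by simp
  finally show ?thesis .
qed

section \<open>Transfer to the tensor product\<close>

text \<open>The deterministic part: each of \<open>x\<close> and \<open>y\<close> contributes at
  most half of the error \<open>\<epsilon> * n\<^sup>2 * q\<close> in the numerator, and the
  denominator is at least \<open>n\<^sup>2 * q\<close>.\<close>

lemma isolated_ratio_bound:
  fixes q \<epsilon> x y n :: real
  assumes n: "n > 0" and q: "0 < q" "q \<le> 1" and y: "0 \<le> y" "y \<le> n"
    and x_close: "\<bar>x - n * q\<bar> < n * q * \<epsilon> / 2" and y_close: "\<bar>y - n * q\<bar> < n * q * \<epsilon> / 2"
  shows "\<bar>(n * n - (n - x) * (n - y)) / (2 * n\<^sup>2 * q - n\<^sup>2 * q\<^sup>2) - 1\<bar> \<le> \<epsilon>"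
proof -
  let ?D = "2 * n\<^sup>2 * q - n\<^sup>2 * q\<^sup>2"
  have "n\<^sup>2 * q\<^sup>2 \<le> n\<^sup>2 * q"
    using n q by (intro mult_left_mono) (auto simp: power2_eq_square mult_le_one)
  then have D: "n\<^sup>2 * q \<le> ?D" by linarith
  have nq: "0 < n\<^sup>2 * q" using n q by simp
  \<comment> \<open>Positivity of \<open>\<epsilon>\<close> comes from the strict inequality in
    \<open>x_close\<close>.\<close>
  have "0 < n * q * \<epsilon>"
    using le_less_trans[OF abs_ge_zero x_close] by linarith
  then have \<epsilon>: "\<epsilon> > 0"
    using mult_pos_pos[OF n q(1)] by (rule zero_less_mult_pos)
  \<comment> \<open>Since \<open>?D\<close> is \<open>n\<^sup>2 - (n - n * q)\<^sup>2\<close>, this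
    telescopes by replacing one factor at a time. Both cofactors, \<open>n - y\<close> and
    \<open>n * (1 - q)\<close>, lie between 0 and \<open>n\<close>.\<close>
  have "n * n - (n - x) * (n - y) - ?D = (x - n * q) * (n - y) + n * (1 - q) * (y - n * q)"
    by (simp add: algebra_simps power2_eq_square)
  then have "\<bar>n * n - (n - x) * (n - y) - ?D\<bar> \<le> \<bar>x - n * q\<bar> * \<bar>n - y\<bar> + n * \<bar>1 - q\<bar> * \<bar>y - n * q\<bar>"
    using n abs_triangle_ineq[of "(x - n * q) * (n - y)" "n * (1 - q) * (y - n * q)"]
    by (simp add: abs_mult)
  also have "\<dots> \<le> (n * q * \<epsilon> / 2) * n + n * 1 * (n * q * \<epsilon> / 2)"
    using assms \<epsilon> by (intro add_mono mult_mono) auto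
  also have "\<dots> = \<epsilon> * (n\<^sup>2 * q)"
    by (simp add: power2_eq_square)
  also have "\<dots> \<le> \<epsilon> * ?D"
    using D \<epsilon> by (intro mult_left_mono) auto
  finally have main: "\<bar>n * n - (n - x) * (n - y) - ?D\<bar> \<le> \<epsilon> * ?D" .
  have Dpos: "?D > 0" using D nq by linarith
  then have D_nz: "?D \<noteq> 0" by (rule less_imp_neq[symmetric])
  have "(n * n - (n - x) * (n - y)) / ?D - 1 = (n * n - (n - x) * (n - y) - ?D) / ?D"
    by (simp only: diff_divide_distrib[of "n * n - (n - x) * (n - y)" ?D] divide_self[OF D_nz])
  then show ?thesis
    using main Dpos by (simp add: abs_divide pos_divide_le_eq)
qed

text \<open>A large deviation of the ratio forces one of the two counts to deviate by at least
  \<open>a\<close>; a union bound over the two marginals then reduces to Chebyshev for one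
  graph.\<close>

lemma tensor_product_isolated_deviation:
  fixes n :: nat and p \<epsilon> :: real
  assumes p: "0 \<le> p" "p < 1" and n: "n \<ge> 2" and \<epsilon>: "\<epsilon> > 0"
  shows "measure_pmf.prob (pair_pmf (erdos_renyi n p) (erdos_renyi n p))
     {\<omega>. \<epsilon> < \<bar>(case \<omega> of (G, H) \<Rightarrow> real (card (isolated_vertices (tensor_product G H))) /
        (2 * real n ^ 2 * (1 - p) ^ (n - 1) - real n ^ 2 * (1 - p) ^ (2 * n - 2))) - 1\<bar>}
     \<le> 8 / \<epsilon>\<^sup>2 * (1 / (real n * (1 - p) ^ n) + 1 / (1 - p) - 1)"
    (is "measure_pmf.prob ?P ?E \<le> _")
proof -
  define q where "q = (1 - p) ^ (n - 1)"
  define a where "a = n * q * \<epsilon> / 2"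
  define B where "B = {G :: nat graph. a \<le> \<bar>real (card (isolated_vertices G)) - n * q\<bar>}"
  have q: "0 < q" "q \<le> 1"
    using p by (auto simp: q_def power_le_one)
  have a: "a > 0" using q n \<epsilon> by (simp add: a_def)
  have "2 * n - 2 = (n - 1) * 2" by simp
  then have q_sq: "(1 - p) ^ (2 * n - 2) = q\<^sup>2"
    by (simp only: q_def power_mult)
  have ratio: "\<bar>real (card (isolated_vertices (tensor_product G H))) /
        (2 * real n ^ 2 * q - real n ^ 2 * q\<^sup>2) - 1\<bar> \<le> \<epsilon>"
    if G: "G \<in> set_pmf (erdos_renyi n p)" "G \<notin> B" and H: "H \<in> set_pmf (erdos_renyi n p)" "H \<notin> B"
    for G H
  proof -
    have v: "verts G = {1..n}" "verts H = {1..n}"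
      using G H verts_erdos_renyi by auto
    have "card (isolated_vertices H) \<le> card {1..n}"
      by (intro card_mono) (auto simp: v isolated_vertices_def)
    then show ?thesis
      using isolated_ratio_bound[of n q "real (card (isolated_vertices H))"
          "real (card (isolated_vertices G))" \<epsilon>] q n G(2) H(2)
      by (simp add: card_isolated_vertices_tensor_product v B_def a_def not_le)
  qed
  have "measure_pmf.prob ?P ?E \<le> measure_pmf.prob ?P (fst -` B \<union> snd -` B)"
  proof (rule measure_pmf.finite_measure_mono_AE)
    show "AE \<omega> in ?P. \<omega> \<in> ?E \<longrightarrow> \<omega> \<in> fst -` B \<union> snd -` B"
    proof (rule AE_pmfI, rule impI, rule ccontr)
      fix \<omega> assume supp: "\<omega> \<in> set_pmf ?P" and E: "\<omega> \<in> ?E" and B: "\<omega> \<notin> fst -` B \<union> snd -` B"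
      obtain G H where \<omega>: "\<omega> = (G, H)" by (cases \<omega>)
      have "\<not> \<epsilon> < \<bar>real (card (isolated_vertices (tensor_product G H))) /
          (2 * real n ^ 2 * q - real n ^ 2 * q\<^sup>2) - 1\<bar>"
        unfolding not_less using supp B by (intro ratio) (auto simp: \<omega>)
      then show False
        using E unfolding \<omega> mem_Collect_eq case_prod_conv q_sq q_def[symmetric] by contradiction
    qed
  qed simp
  also have "\<dots> \<le> measure_pmf.prob ?P (fst -` B) + measure_pmf.prob ?P (snd -` B)"
    by (intro measure_Un_le) auto
  also have "\<dots> = 2 * measure_pmf.prob (erdos_renyi n p) B"
    by (simp add: measure_map_pmf[symmetric] map_fst_pair_pmf map_snd_pair_pmf del: measure_map_pmf)
  also have "\<dots> \<le> 2 * ((n * q + real n * (real n - 1) * (1 - p) ^ (2 * n - 3) - (n * q)\<^sup>2) / a\<^sup>2)"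
    using isolated_vertices_concentration[of p a n] p a
    unfolding B_def q_def by (intro mult_left_mono) auto
  \<comment> \<open>The shared potential edge of two vertices is counted once, not twice; this is
    the source of the correlation factor \<open>1 / (1 - p)\<close>.\<close>
  also have "(1 - p) ^ (2 * n - 3) = q\<^sup>2 / (1 - p)"
  proof -
    have "2 * n - 2 = Suc (2 * n - 3)" using n by simp
    then show ?thesis
      using p q_sq by (simp add: field_simps)
  qed
  \<comment> \<open>The 8 is the 2 of the union bound times the 4 from the halved tolerance in
    \<open>a\<^sup>2\<close>.\<close>
  also have "2 * ((n * q + real n * (real n - 1) * (q\<^sup>2 / (1 - p)) - (n * q)\<^sup>2) / a\<^sup>2) =
      8 / \<epsilon>\<^sup>2 * (1 / (n * q) + (real n - 1) / real n * (1 / (1 - p)) - 1)"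
    using q n \<epsilon> p by (simp add: a_def field_simps power2_eq_square)
  \<comment> \<open>Weakening the exponent \<open>n - 1\<close> to \<open>n\<close> and dropping
    \<open>(n - 1) / n\<close> leaves a form suited to the limit of
    \<open>(1 - c / n) ^ n\<close>.\<close>
  also have "\<dots> \<le> 8 / \<epsilon>\<^sup>2 * (1 / (real n * (1 - p) ^ n) + 1 / (1 - p) - 1)"
  proof (intro mult_left_mono diff_mono add_mono)
    have "(1 - p) ^ n \<le> q"
      unfolding q_def using p by (intro power_decreasing) auto
    then show "1 / (n * q) \<le> 1 / (real n * (1 - p) ^ n)"
      using p n by (intro divide_left_mono mult_left_mono mult_pos_pos) (auto simp: q)
    show "(real n - 1) / real n * (1 / (1 - p)) \<le> 1 / (1 - p)"
      using p n by (intro mult_left_le_one_le) auto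
  qed auto
  finally show ?thesis .
qed

text \<open>As \<open>(1 - c / n) ^ n\<close> tends to \<open>exp (-c) > 0\<close>, the first
  fraction is of order \<open>1 / n\<close>; the second tends to 1 and cancels the
  \<open>- 1\<close>.\<close>

lemma deviation_bound_tendsto_0:
  fixes c K :: real
  shows "(\<lambda>n. K * (1 / (real n * (1 - c / n) ^ n) + 1 / (1 - c / n) - 1)) \<longlonglongrightarrow> 0"
proof -
  have "(\<lambda>n. (1 + (-c) / real n) ^ n) \<longlonglongrightarrow> exp (-c)"
    by (rule tendsto_exp_limit_sequentially)
  then have "(\<lambda>n. 1 / real n * inverse ((1 - c / n) ^ n)) \<longlonglongrightarrow> 0 * inverse (exp (-c))"
    by (intro tendsto_mult lim_1_over_n tendsto_inverse) auto
  then have 1: "(\<lambda>n. 1 / (real n * (1 - c / n) ^ n)) \<longlonglongrightarrow> 0"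
    by (simp add: field_simps)
  have "(\<lambda>n. 1 / (1 - c / real n)) \<longlonglongrightarrow> 1 / (1 - 0)"
    by (intro tendsto_intros lim_const_over_n) auto
  then have "(\<lambda>n. 1 / (1 - c / real n)) \<longlonglongrightarrow> 1"
    by simp
  then have "(\<lambda>n. K * (1 / (real n * (1 - c / n) ^ n) + 1 / (1 - c / n) - 1)) \<longlonglongrightarrow> K * (0 + 1 - 1)"
    using 1 by (intro tendsto_intros)
  then show ?thesis by simp
qed

theorem theorem6p2:
  fixes c :: real and p :: "nat \<Rightarrow> real"
  assumes "c > 1"
    and "\<And>n. real n > c \<Longrightarrow> p n = c / real n"
  shows "converges_in_probability
           (\<lambda>n. measure_pmf (pair_pmf (erdos_renyi n (p n)) (erdos_renyi n (p n))))
           (\<lambda>n (G, H). real (card (isolated_vertices (tensor_product G H))) /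
              (2 * real n ^ 2 * (1 - p n) ^ (n - 1) - real n ^ 2 * (1 - p n) ^ (2 * n - 2)))
           1"
  unfolding converges_in_probability_def
proof (intro conjI allI impI)
  fix \<epsilon> :: real assume \<epsilon>: "\<epsilon> > 0"
  let ?R = "\<lambda>n (G, H). real (card (isolated_vertices (tensor_product G H))) /
              (2 * real n ^ 2 * (1 - p n) ^ (n - 1) - real n ^ 2 * (1 - p n) ^ (2 * n - 2))"
  let ?P = "\<lambda>n. measure_pmf (pair_pmf (erdos_renyi n (p n)) (erdos_renyi n (p n)))"
  \<comment> \<open>\<open>p n\<close> is prescribed only for \<open>n > c\<close>, so the bound is
    claimed only eventually.\<close>
  have "eventually (\<lambda>n. real n > c) sequentially"
    by (intro eventually_compose_filterlim[OF eventually_gt_at_top filterlim_real_sequentially])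
  then have bound: "eventually (\<lambda>n. measure (?P n) {\<omega> \<in> space (?P n). \<bar>?R n \<omega> - 1\<bar> > \<epsilon>} \<le>
      8 / \<epsilon>\<^sup>2 * (1 / (real n * (1 - c / n) ^ n) + 1 / (1 - c / n) - 1)) sequentially"
  proof eventually_elim
    case (elim n)
    \<comment> \<open>The bound \<open>2 \<le> n\<close> follows from
      \<open>n > c > 1\<close>.\<close>
    have "2 \<le> n" "0 \<le> c / n" "c / n < 1"
      using elim \<open>c > 1\<close> by auto
    with tensor_product_isolated_deviation[of "c / n" n \<epsilon>] \<epsilon> show ?case
      unfolding assms(2)[OF elim] by (simp only: space_measure_pmf UNIV_I simp_thms)
  qed
  show "(\<lambda>n. measure (?P n) {\<omega> \<in> space (?P n). \<bar>?R n \<omega> - 1\<bar> > \<epsilon>}) \<longlonglongrightarrow> 0"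
    by (rule tendsto_sandwich[OF _ bound tendsto_const deviation_bound_tendsto_0]) simp
qed simp

end
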